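(* Let $u=u_k\in H$ ($k\le k_{\max}$) be an eigenvector corresponding to the eigenvalue $\lambda=\lambda_k$, let $\Lambda$ be a neighborhood of $\lambda$, $u^e=\mathcal E u$, and let $I_{V_h}:{\rm range}(\mathcal E)\to V_h$ be a linear operator. Then $$|||u^e-Q_h^\Lambda u^e|||_h\le(\gamma_\Lambda+1)\Big(\tilde\lambda_n^{1/2}\,\|u^e-I_{V_h}u^e\|_h+3\,|||u^e-I_{V_h}u^e|||_h\Big)+\gamma_\Lambda\,\|d_\lambda(u^e,\cdot)\|_{V_h'} .$$
   Context: Setting. $H\subset\hat H$ are infinite-dimensional real Hilbert spaces, $H$ compactly embedded in $\hat H$; $a:H\times H\to\mathbb R$ is a bounded symmetric elliptic bilinear form; $b(\cdot,\cdot)$ is the scalar product of $\hat H$. Let $0<\lambda_1\le\lambda_2\le\dots$ be the eigenvalues (with multiplicity, tending to infinity) and $u_1,u_2,\ldots\in H$ corresponding eigenvectors of $a(u,v)=\lambda b(u,v)$ for all $v\in H$, with $a(u_k,u_\ell)=\lambda_k\delta_{k\ell}$, $b(u_k,u_\ell)=\delta_{k\ell}$. Fix $k_{\max}\in\mathbb N$. $H^{\rm ex}$ is a further real vector space and $\mathcal E:H\to H^{\rm ex}$ is a linear injective extension operator. $V_h\subset H^{\rm ex}$ is a finite-dimensional subspace, $n:=\dim V_h$. $a_h(\cdot,\cdot)$, $b_h(\cdot,\cdot)$ are symmetric positive semidefinite bilinear forms on $H^{\rm ex}$ that are positive definite on $V_h$; $|||u|||_h:=a_h(u,u)^{1/2}$,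 $\|u\|_h:=b_h(u,u)^{1/2}$. Discrete eigenproblem: $\tilde u_1,\dots,\tilde u_n\in V_h$ is a basis of $V_h$ and $0<\tilde\lambda_1\le\dots\le\tilde\lambda_n$ are such that $a_h(\tilde u_k,\tilde u_\ell)=\tilde\lambda_k\delta_{k\ell}$, $b_h(\tilde u_k,\tilde u_\ell)=\delta_{k\ell}$ (so $\tilde\lambda_n$ is the largest discrete eigenvalue). For a neighborhood $\Lambda$ of $\lambda$ (so $\lambda\in\Lambda$) define $$Q_h^\Lambda w:=\sum_{\tilde\lambda_i\in\Lambda}b_h(w,\tilde u_i)\tilde u_i\quad(w\in H^{\rm ex}),\qquad\gamma_\Lambda:=\max_{\tilde\lambda_i\notin\Lambda}\frac{\tilde\lambda_i}{|\tilde\lambda_i-\lambda|}.$$ The defect is $d_\lambda(w,v):=a_h(w,v)-\lambda b_h(w,v)$, $w,v\in H^{\rm ex}$, and for $L\in V_h'$, $\|L\|_{V_h'}:=\max_{0\ne v_h\in V_h}L(v_h)/|||v_h|||_h$. *)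

theory Defs
  imports "HOL-Analysis.Analysis"
begin

definition finite_dimensional_subspace :: "'a::real_vector set \<Rightarrow> bool" where
  "finite_dimensional_subspace V \<longleftrightarrow> subspace V \<and> (\<exists>B. finite B \<and> span B = V)"

definition compact_linear_operator ::
    "('a::real_normed_vector \<Rightarrow> 'b::real_normed_vector) \<Rightarrow> bool" where
  "compact_linear_operator T \<longleftrightarrow>
     bounded_linear T \<and> (\<forall>S. bounded S \<longrightarrow> compact (closure (T ` S)))"

definition linear_map_on :: "'a::real_vector set \<Rightarrow> ('a \<Rightarrow> 'b::real_vector) \<Rightarrow> bool" where
  "linear_map_on S f \<longleftrightarrow>
     (\<forall>x\<in>S. \<forall>y\<in>S. f (x + y) = f x + f y) \<and> (\<forall>c. \<forall>x\<in>S. f (c *\<^sub>R x) = c *\<^sub>R f x)"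

definition eigenspace ::
    "('a \<Rightarrow> 'a \<Rightarrow> real) \<Rightarrow> ('a \<Rightarrow> 'a \<Rightarrow> real) \<Rightarrow> real \<Rightarrow> 'a set" where
  "eigenspace a b \<mu> = {u. \<forall>v. a u v = \<mu> * b u v}"

text \<open>
  The inclusion of the Hilbert space \<open>H\<close> (type \<open>'h\<close>) into the Hilbert space \<open>Hhat\<close>
  (type \<open>'g\<close>) is the injective map \<open>\<iota>\<close>, so that on \<open>H\<close> the scalar product of \<open>Hhat\<close> reads
  \<open>\<iota> u \<bullet> \<iota> v\<close>. All sequences are indexed from 1. Listing the eigenvalues with multiplicity
  means that each real \<open>\<mu>\<close> occurs exactly \<open>dim (eigenspace a b \<mu>)\<close> times.
\<close>

locale elliptic_eigenproblem =
  fixes \<iota> :: "'h::{real_inner, complete_space} \<Rightarrow> 'g::{real_inner, complete_space}"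
    and a b :: "'h \<Rightarrow> 'h \<Rightarrow> real"
    and lam :: "nat \<Rightarrow> real"
    and u :: "nat \<Rightarrow> 'h"
  assumes infinite_dimensional_H: "\<not> finite_dimensional_subspace (UNIV :: 'h set)"
    and infinite_dimensional_Hhat: "\<not> finite_dimensional_subspace (UNIV :: 'g set)"
    and embedding_injective: "inj \<iota>"
    and embedding_compact: "compact_linear_operator \<iota>"
    and a_bounded_bilinear: "bounded_bilinear a"
    and a_symmetric: "\<And>v w. a v w = a w v"
    and a_elliptic: "\<exists>\<alpha>>0. \<forall>v. a v v \<ge> \<alpha> * (norm v)\<^sup>2"
    and b_eq: "\<And>v w. b v w = \<iota> v \<bullet> \<iota> w"
    and lam_pos: "0 < lam 1"
    and lam_mono: "mono_on {1..} lam"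
    and lam_at_top: "filterlim lam at_top sequentially"
    and lam_multiplicity: "\<And>\<mu>. card {k. 1 \<le> k \<and> lam k = \<mu>} = dim (eigenspace a b \<mu>)"
    and eigenvector: "\<And>k v. 1 \<le> k \<Longrightarrow> a (u k) v = lam k * b (u k) v"
    and a_orthogonal:
      "\<And>k l. 1 \<le> k \<Longrightarrow> 1 \<le> l \<Longrightarrow> a (u k) (u l) = (if k = l then lam k else 0)"
    and b_orthonormal:
      "\<And>k l. 1 \<le> k \<Longrightarrow> 1 \<le> l \<Longrightarrow> b (u k) (u l) = (if k = l then 1 else 0)"

locale discrete_eigenproblem =
  fixes ah bh :: "'e::real_vector \<Rightarrow> 'e \<Rightarrow> real"
    and Vh :: "'e set"
    and n :: nat
    and lamh :: "nat \<Rightarrow> real"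
    and uh :: "nat \<Rightarrow> 'e"
  assumes Vh_finite_dimensional: "finite_dimensional_subspace Vh"
    and n_eq: "n = dim Vh"
    and n_pos: "1 \<le> n"
    and ah_bilinear: "bilinear ah"
    and ah_symmetric: "\<And>v w. ah v w = ah w v"
    and ah_semidefinite: "\<And>v. 0 \<le> ah v v"
    and ah_definite_on: "\<And>v. v \<in> Vh \<Longrightarrow> v \<noteq> 0 \<Longrightarrow> 0 < ah v v"
    and bh_bilinear: "bilinear bh"
    and bh_symmetric: "\<And>v w. bh v w = bh w v"
    and bh_semidefinite: "\<And>v. 0 \<le> bh v v"
    and bh_definite_on: "\<And>v. v \<in> Vh \<Longrightarrow> v \<noteq> 0 \<Longrightarrow> 0 < bh v v"
    and uh_inj: "inj_on uh {1..n}"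
    and uh_independent: "independent (uh ` {1..n})"
    and uh_span: "span (uh ` {1..n}) = Vh"
    and lamh_pos: "0 < lamh 1"
    and lamh_mono: "mono_on {1..n} lamh"
    and ah_orthogonal:
      "\<And>k l. k \<in> {1..n} \<Longrightarrow> l \<in> {1..n} \<Longrightarrow> ah (uh k) (uh l) = (if k = l then lamh k else 0)"
    and bh_orthonormal:
      "\<And>k l. k \<in> {1..n} \<Longrightarrow> l \<in> {1..n} \<Longrightarrow> bh (uh k) (uh l) = (if k = l then 1 else 0)"

text \<open>The seminorm of a positive semidefinite form.\<close>

definition form_norm :: "('e \<Rightarrow> 'e \<Rightarrow> real) \<Rightarrow> 'e \<Rightarrow> real" where
  "form_norm c w = sqrt (c w w)"

definition spectral_proj ::
    "('e::real_vector \<Rightarrow> 'e \<Rightarrow> real) \<Rightarrow> nat \<Rightarrow> (nat \<Rightarrow> real) \<Rightarrow> (nat \<Rightarrow> 'e) \<Rightarrow> real set \<Rightarrow> 'e \<Rightarrow> 'e" where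
  "spectral_proj bh n lamh uh \<Lambda> w = (\<Sum>i | i \<in> {1..n} \<and> lamh i \<in> \<Lambda>. bh w (uh i) *\<^sub>R uh i)"

text \<open>
  The maximum over the empty set is 0; this occurs when all discrete eigenvalues lie in \<open>\<Lambda>\<close>.
\<close>

definition spectral_gap_const :: "nat \<Rightarrow> (nat \<Rightarrow> real) \<Rightarrow> real set \<Rightarrow> real \<Rightarrow> real" where
  "spectral_gap_const n lamh \<Lambda> l =
     (if \<forall>i\<in>{1..n}. lamh i \<in> \<Lambda> then 0
      else Max {lamh i / \<bar>lamh i - l\<bar> | i. i \<in> {1..n} \<and> lamh i \<notin> \<Lambda>})"

definition defect ::
    "('e \<Rightarrow> 'e \<Rightarrow> real) \<Rightarrow> ('e \<Rightarrow> 'e \<Rightarrow> real) \<Rightarrow> real \<Rightarrow> 'e \<Rightarrow> 'e \<Rightarrow> real" where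
  "defect ah bh l w v = ah w v - l * bh w v"

text \<open>
  For a linear functional on a nontrivial finite-dimensional space the supremum is attained,
  hence a maximum.
\<close>

definition dual_norm ::
    "('e::real_vector \<Rightarrow> 'e \<Rightarrow> real) \<Rightarrow> 'e set \<Rightarrow> ('e \<Rightarrow> real) \<Rightarrow> real" where
  "dual_norm ah Vh L = (SUP v\<in>Vh - {0}. L v / form_norm ah v)"

end

theory Submission
  imports Defs
begin

text \<open>
  Let \<open>P\<close> be the \<open>b\<^sub>h\<close>-orthogonal and \<open>R\<close> the \<open>a\<^sub>h\<close>-orthogonal (Galerkin) projection onto \<open>V\<^sub>h\<close>,
  and let \<open>z \<in> V\<^sub>h\<close> be the \<open>a\<^sub>h\<close>-Riesz representative of the defect of \<open>w\<close>. Comparing coefficients in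
  the discrete eigenbasis, \<open>(\<mu>\<^sub>i - \<lambda>) b\<^sub>h(w, u\<^sub>i) = \<mu>\<^sub>i (z - (R w - P w))\<^sub>i\<close>, so that
  \<open>P w - Q w\<close>, which only involves eigenvalues \<open>\<mu>\<^sub>i\<close> outside \<open>\<Lambda>\<close>, is bounded by \<open>\<gamma>\<close> times
  \<open>z - (R w - P w)\<close>. Since \<open>P\<close> and \<open>R\<close> reproduce \<open>V\<^sub>h\<close>, both \<open>w - P w\<close> and \<open>R w - P w\<close> depend only on
  the interpolation error \<open>e\<close>, and \<open>|||P e||| \<le> \<mu>\<^sub>n\<^sup>1\<^sup>/\<^sup>2 \<parallel>e\<parallel>\<close> by the inverse estimate on \<open>V\<^sub>h\<close>.
\<close>

section \<open>Seminorms of positive semidefinite bilinear forms\<close>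

lemma bilinear_form_Cauchy_Schwarz:
  fixes c :: "'e::real_vector \<Rightarrow> 'e \<Rightarrow> real"
  assumes bil: "bilinear c" and sym: "\<And>x y. c x y = c y x" and pos: "\<And>x. 0 \<le> c x x"
  shows "c x y \<le> form_norm c x * form_norm c y"
proof -
  \<comment> \<open>Both coefficients stay free because \<open>c y y\<close> may vanish for nonzero
    \<open>y\<close>, so normalising by it is not always possible.\<close>
  have quad: "0 \<le> s\<^sup>2 * c x x - 2 * s * t * c x y + t\<^sup>2 * c y y" for s t
  proof -
    have "0 \<le> c (s *\<^sub>R x - t *\<^sub>R y) (s *\<^sub>R x - t *\<^sub>R y)" by (rule pos)
    also have "\<dots> = s\<^sup>2 * c x x - 2 * s * t * c x y + t\<^sup>2 * c y y"
      using sym[of y x]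
      by (simp add: bilinear_lsub[OF bil] bilinear_rsub[OF bil] bilinear_lmul[OF bil]
          bilinear_rmul[OF bil] power2_eq_square algebra_simps)
    finally show ?thesis .
  qed
  have "(c x y)\<^sup>2 \<le> c x x * c y y"
  proof (cases "c y y = 0")
    case True
    have "c x y = 0"
    proof (rule ccontr)
      assume nz: "c x y \<noteq> 0"
      \<comment> \<open>With \<open>c y y = 0\<close> the quadratic is affine in \<open>t\<close>;
        this \<open>t\<close> makes the linear term exceed \<open>c x x\<close> by exactly
        1.\<close>
      have "0 \<le> c x x - (c x x + 1)"
        using quad[of 1 "(c x x + 1) / (2 * c x y)"] True nz by simp
      then show False by simp
    qed
    then show ?thesis using True by simp
  next
    case False
    \<comment> \<open>The minimising ratio \<open>t / s = c x y / c y y\<close>, cleared of its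
      denominator.\<close>
    have "0 \<le> c y y * (c x x * c y y - (c x y)\<^sup>2)"
      using quad[of "c y y" "c x y"] by (simp add: power2_eq_square algebra_simps)
    then show ?thesis using False pos[of y] by (simp add: zero_le_mult_iff)
  qed
  then show ?thesis
    unfolding form_norm_def real_sqrt_mult[symmetric] by (rule real_le_rsqrt)
qed

lemma form_norm_nonneg: "(\<And>x. 0 \<le> c x x) \<Longrightarrow> 0 \<le> form_norm c x"
  by (simp add: form_norm_def)

lemma form_norm_triangle_ineq:
  fixes c :: "'e::real_vector \<Rightarrow> 'e \<Rightarrow> real"
  assumes bil: "bilinear c" and sym: "\<And>x y. c x y = c y x" and pos: "\<And>x. 0 \<le> c x x"
  shows "form_norm c (x + y) \<le> form_norm c x + form_norm c y"
proof -
  have sq: "(form_norm c v)\<^sup>2 = c v v" for v by (simp add: form_norm_def pos)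
  have "c (x + y) (x + y) = c x x + 2 * c x y + c y y"
    using sym[of y x] by (simp add: bilinear_ladd[OF bil] bilinear_radd[OF bil])
  also have "\<dots> \<le> (form_norm c x + form_norm c y)\<^sup>2"
    using bilinear_form_Cauchy_Schwarz[OF assms, of x y] by (simp add: power2_sum sq)
  finally show ?thesis
    unfolding form_norm_def[of c "x + y"]
    by (simp add: real_le_lsqrt form_norm_nonneg pos)
qed

lemma form_norm_diff_le:
  fixes c :: "'e::real_vector \<Rightarrow> 'e \<Rightarrow> real"
  assumes bil: "bilinear c" and sym: "\<And>x y. c x y = c y x" and pos: "\<And>x. 0 \<le> c x x"
  shows "form_norm c (x - y) \<le> form_norm c x + form_norm c y"
  using form_norm_triangle_ineq[OF assms, of x "- y"]
  by (simp add: form_norm_def bilinear_lneg[OF bil] bilinear_rneg[OF bil])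

section \<open>Coordinates in the discrete eigenbasis and the two projections\<close>

context discrete_eigenproblem
begin

declare One_nat_def [simp del]

lemmas ah_Cauchy_Schwarz = bilinear_form_Cauchy_Schwarz[OF ah_bilinear ah_symmetric ah_semidefinite]
lemmas ah_triangle_ineq = form_norm_triangle_ineq[OF ah_bilinear ah_symmetric ah_semidefinite]
lemmas ah_diff_le = form_norm_diff_le[OF ah_bilinear ah_symmetric ah_semidefinite]
lemmas ah_norm_nonneg = form_norm_nonneg[of ah, OF ah_semidefinite]

abbreviation comb :: "(nat \<Rightarrow> real) \<Rightarrow> 'e" where
  "comb f \<equiv> \<Sum>i = 1..n. f i *\<^sub>R uh i"

definition L2_proj :: "'e \<Rightarrow> 'e" where
  "L2_proj w = comb (\<lambda>i. bh w (uh i))"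

text \<open>The eigenvectors are normalised in \<open>bh\<close>, so
  \<open>ah (uh i) (uh i) = lamh i\<close>; dividing by it gives the \<open>ah\<close>-Fourier
  coefficients.\<close>

definition galerkin_proj :: "'e \<Rightarrow> 'e" where
  "galerkin_proj w = comb (\<lambda>i. ah w (uh i) / lamh i)"

lemma lamh_positive: "i \<in> {1..n} \<Longrightarrow> 0 < lamh i"
  using lamh_pos monotone_onD[OF lamh_mono, of 1 i] n_pos by force

lemma lamh_le_last: "i \<in> {1..n} \<Longrightarrow> lamh i \<le> lamh n"
  using monotone_onD[OF lamh_mono, of i n] n_pos by force

lemma ah_comb_right: "ah w (comb f) = (\<Sum>i = 1..n. f i * ah w (uh i))"
  using ah_bilinear by (simp add: bilinear_def linear_sum linear_cmul)

lemma bh_comb_right: "bh w (comb f) = (\<Sum>i = 1..n. f i * bh w (uh i))"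
  using bh_bilinear by (simp add: bilinear_def linear_sum linear_cmul)

lemma ah_comb_uh: "i \<in> {1..n} \<Longrightarrow> ah (comb f) (uh i) = lamh i * f i"
  by (subst ah_symmetric) (simp add: ah_comb_right ah_orthogonal if_distrib cong: if_cong)

lemma bh_comb_uh: "i \<in> {1..n} \<Longrightarrow> bh (comb f) (uh i) = f i"
  by (subst bh_symmetric) (simp add: bh_comb_right bh_orthonormal if_distrib cong: if_cong)

lemma ah_comb_comb: "ah (comb f) (comb g) = (\<Sum>i = 1..n. lamh i * f i * g i)"
  unfolding ah_comb_right[of _ g] by (intro sum.cong refl) (simp add: ah_comb_uh)

lemma bh_comb_comb: "bh (comb f) (comb g) = (\<Sum>i = 1..n. f i * g i)"
  unfolding bh_comb_right[of _ g] by (intro sum.cong refl) (simp add: bh_comb_uh)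

lemma Vh_eq_comb:
  assumes "v \<in> Vh"
  obtains f where "v = comb f"
proof -
  have "v \<in> span (uh ` {1..n})" using assms uh_span by simp
  then obtain g where "v = (\<Sum>x\<in>uh ` {1..n}. g x *\<^sub>R x)"
    by (auto simp: span_finite)
  then have "v = comb (\<lambda>i. g (uh i))" by (simp add: sum.reindex[OF uh_inj])
  then show thesis by (rule that)
qed

lemma comb_in_Vh: "comb f \<in> Vh"
  unfolding uh_span[symmetric] by (intro span_sum span_scale span_base) auto

lemma L2_proj_id: "v \<in> Vh \<Longrightarrow> L2_proj v = v"
  by (erule Vh_eq_comb) (auto simp: L2_proj_def bh_comb_uh intro!: sum.cong)

lemma galerkin_proj_id:
  assumes "v \<in> Vh"
  shows "galerkin_proj v = v"
proof -
  obtain f where v: "v = comb f" using assms by (rule Vh_eq_comb)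
  have "ah v (uh i) / lamh i = f i" if "i \<in> {1..n}" for i
    using lamh_positive[OF that] unfolding v ah_comb_uh[OF that] by simp
  then show ?thesis unfolding galerkin_proj_def v by (intro sum.cong refl) simp
qed

lemma L2_proj_diff: "L2_proj (v - w) = L2_proj v - L2_proj w"
  by (simp add: L2_proj_def bilinear_lsub[OF bh_bilinear] scaleR_left_diff_distrib sum_subtractf)

lemma galerkin_proj_diff: "galerkin_proj (v - w) = galerkin_proj v - galerkin_proj w"
  by (simp add: galerkin_proj_def bilinear_lsub[OF ah_bilinear] diff_divide_distrib
      scaleR_left_diff_distrib sum_subtractf)

text \<open>Pythagoras: the residual \<open>w - galerkin_proj w\<close> is
  \<open>ah\<close>-orthogonal to the projection, and its square is nonnegative.\<close>

lemma galerkin_proj_norm_le: "form_norm ah (galerkin_proj w) \<le> form_norm ah w"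
proof -
  let ?g = "galerkin_proj w"
  have orth: "ah ?g ?g = ah w ?g"
    unfolding galerkin_proj_def ah_comb_right
    by (intro sum.cong refl) (use lamh_positive in \<open>fastforce simp: ah_comb_uh\<close>)
  have "0 \<le> ah (w - ?g) (w - ?g)" by (rule ah_semidefinite)
  also have "\<dots> = ah w w - ah ?g ?g"
    using orth ah_symmetric[of ?g w]
    by (simp add: bilinear_lsub[OF ah_bilinear] bilinear_rsub[OF ah_bilinear])
  finally show ?thesis by (simp add: form_norm_def)
qed

lemma L2_proj_norm_le: "form_norm ah (L2_proj w) \<le> sqrt (lamh n) * form_norm bh w"
proof -
  let ?p = "L2_proj w"
  have orth: "bh ?p ?p = bh w ?p"
    unfolding L2_proj_def bh_comb_right by (intro sum.cong refl) (simp add: bh_comb_uh)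
  have "0 \<le> bh (w - ?p) (w - ?p)" by (rule bh_semidefinite)
  also have "\<dots> = bh w w - bh ?p ?p"
    using orth bh_symmetric[of ?p w]
    by (simp add: bilinear_lsub[OF bh_bilinear] bilinear_rsub[OF bh_bilinear])
  finally have bessel: "bh ?p ?p \<le> bh w w" by simp
  \<comment> \<open>Inverse estimate: both forms are diagonal in the eigenbasis, and every weight
    \<open>lamh i\<close> is at most the last one.\<close>
  have "ah ?p ?p \<le> lamh n * bh ?p ?p"
    unfolding L2_proj_def ah_comb_comb bh_comb_comb sum_distrib_left mult.assoc
    by (intro sum_mono mult_right_mono lamh_le_last) auto
  also have "\<dots> \<le> lamh n * bh w w"
    using lamh_positive[of n] n_pos by (intro mult_left_mono bessel) auto
  finally show ?thesis by (simp add: form_norm_def flip: real_sqrt_mult)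
qed

section \<open>The dual norm and Riesz representatives\<close>

lemma le_dual_norm:
  assumes "linear L" and v: "v \<in> Vh" "v \<noteq> 0"
  shows "L v / form_norm ah v \<le> dual_norm ah Vh L"
proof -
  define z where "z = comb (\<lambda>i. L (uh i) / lamh i)"
  have riesz: "L y = ah z y" if "y \<in> Vh" for y
  proof -
    obtain f where y: "y = comb f" using \<open>y \<in> Vh\<close> by (rule Vh_eq_comb)
    have "ah z y = (\<Sum>i = 1..n. f i * L (uh i))"
      unfolding z_def y ah_comb_comb by (intro sum.cong refl) (use lamh_positive in fastforce)
    then show ?thesis by (simp add: y linear_sum[OF assms(1)] linear_cmul[OF assms(1)])
  qed
  \<comment> \<open>Cauchy-Schwarz with the Riesz representative bounds all quotients, so the real
    supremum is a genuine least upper bound.\<close>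
  have "L y / form_norm ah y \<le> form_norm ah z" if "y \<in> Vh - {0}" for y
    using that riesz[of y] ah_Cauchy_Schwarz[of z y] ah_definite_on[of y]
    by (simp add: form_norm_def[of ah y] divide_le_eq)
  then have "bdd_above ((\<lambda>y. L y / form_norm ah y) ` (Vh - {0}))"
    by (intro bdd_aboveI2)
  then show ?thesis
    unfolding dual_norm_def using v by (intro cSUP_upper) auto
qed

text \<open>The quotients at \<open>uh 1\<close> and at its negative are opposite numbers, so one of
  them is nonnegative.\<close>

lemma dual_norm_nonneg:
  assumes "linear L"
  shows "0 \<le> dual_norm ah Vh L"
proof -
  let ?v = "uh 1"
  have v: "?v \<in> Vh" using span_base[of ?v "uh ` {1..n}"] uh_span n_pos by auto
  have nz: "?v \<noteq> 0" using bh_orthonormal[of 1 1] n_pos bilinear_lzero[OF bh_bilinear] by force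
  have "- ?v \<in> Vh" using v Vh_finite_dimensional
    by (simp add: finite_dimensional_subspace_def subspace_neg)
  then have "L (- ?v) / form_norm ah (- ?v) \<le> dual_norm ah Vh L"
    using nz by (intro le_dual_norm assms) auto
  moreover have "form_norm ah (- ?v) = form_norm ah ?v"
    by (simp add: form_norm_def bilinear_lneg[OF ah_bilinear] bilinear_rneg[OF ah_bilinear])
  ultimately show ?thesis
    using le_dual_norm[OF assms v nz] linear_neg[OF assms, of ?v] by auto
qed

text \<open>Testing \<open>L\<close> with its own Riesz representative gives the quotient
  \<open>form_norm ah ?z\<close>; a zero representative is no admissible test vector and is treated
  separately.\<close>

lemma riesz_norm_le_dual_norm:
  assumes "linear L"
  shows "form_norm ah (comb (\<lambda>i. L (uh i) / lamh i)) \<le> dual_norm ah Vh L" (is "form_norm ah ?z \<le> _")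
proof (cases "?z = 0")
  case True
  then show ?thesis using dual_norm_nonneg[OF assms]
    by (simp add: form_norm_def bilinear_lzero[OF ah_bilinear])
next
  case False
  have "L ?z = ah ?z ?z"
    unfolding ah_comb_comb linear_sum[OF assms] linear_cmul[OF assms]
    by (intro sum.cong refl) (use lamh_positive in fastforce)
  then have "L ?z / form_norm ah ?z = form_norm ah ?z"
    by (simp add: form_norm_def real_div_sqrt ah_semidefinite)
  then show ?thesis using le_dual_norm[OF assms comb_in_Vh False] by simp
qed

section \<open>Coefficientwise comparison and the spectral gap constant\<close>

lemma form_norm_comb_le:
  assumes "0 \<le> \<gamma>" and le: "\<And>i. i \<in> {1..n} \<Longrightarrow> \<bar>f i\<bar> \<le> \<gamma> * \<bar>g i\<bar>"
  shows "form_norm ah (comb f) \<le> \<gamma> * form_norm ah (comb g)"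
proof -
  \<comment> \<open>The squared \<open>ah\<close>-seminorm is a sum of squared coefficients with
    positive weights \<open>lamh i\<close>, so it suffices to compare term by term.\<close>
  have "lamh i * (f i * f i) \<le> \<gamma>\<^sup>2 * (lamh i * (g i * g i))" if "i \<in> {1..n}" for i
  proof -
    have "(f i)\<^sup>2 \<le> (\<gamma> * g i)\<^sup>2"
      using le[OF that] \<open>0 \<le> \<gamma>\<close> by (simp add: abs_mult abs_le_square_iff[symmetric])
    then show ?thesis
      using mult_left_mono[of "(f i)\<^sup>2" "(\<gamma> * g i)\<^sup>2" "lamh i"] lamh_positive[OF that]
      by (simp add: power2_eq_square algebra_simps)
  qed
  then have "ah (comb f) (comb f) \<le> \<gamma>\<^sup>2 * ah (comb g) (comb g)"
    unfolding ah_comb_comb sum_distrib_left mult.assoc by (rule sum_mono)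
  then have "form_norm ah (comb f) \<le> sqrt (\<gamma>\<^sup>2 * ah (comb g) (comb g))"
    unfolding form_norm_def by (rule real_sqrt_le_mono)
  then show ?thesis using \<open>0 \<le> \<gamma>\<close> by (simp add: form_norm_def real_sqrt_mult)
qed

lemma spectral_gap_const_ge:
  assumes "i \<in> {1..n}" and "lamh i \<notin> \<Lambda>"
  shows "lamh i / \<bar>lamh i - l\<bar> \<le> spectral_gap_const n lamh \<Lambda> l"
proof -
  have "\<not> (\<forall>i\<in>{1..n}. lamh i \<in> \<Lambda>)" using assms by auto
  then show ?thesis
    unfolding spectral_gap_const_def using assms by (auto intro!: Max_ge)
qed

lemma spectral_gap_const_nonneg: "0 \<le> spectral_gap_const n lamh \<Lambda> l"
proof (cases "\<forall>i\<in>{1..n}. lamh i \<in> \<Lambda>")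
  case True
  then show ?thesis by (simp add: spectral_gap_const_def)
next
  case False
  then obtain i where i: "i \<in> {1..n}" "lamh i \<notin> \<Lambda>" by blast
  have "0 \<le> lamh i / \<bar>lamh i - l\<bar>" using lamh_positive[OF i(1)] by simp
  then show ?thesis using spectral_gap_const_ge[OF i, of l] by linarith
qed

lemma linear_defect: "linear (defect ah bh l w)"
  unfolding defect_def
  using ah_bilinear bh_bilinear
  by (intro linearI) (auto simp: bilinear_radd bilinear_rmul algebra_simps)

text \<open>Padding with zero coefficients puts the restricted sum on the full index range, ready
  for comparison with \<open>L2_proj w\<close>.\<close>

lemma spectral_proj_eq_comb:
  "spectral_proj bh n lamh uh \<Lambda> w = comb (\<lambda>i. if lamh i \<in> \<Lambda> then bh w (uh i) else 0)"
proof -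
  have "{i. i \<in> {1..n} \<and> lamh i \<in> \<Lambda>} = {i \<in> {1..n}. lamh i \<in> \<Lambda>}" by simp
  then show ?thesis
    unfolding spectral_proj_def
    by (simp only: sum.inter_filter finite_atLeastAtMost) (auto intro: sum.cong)
qed

section \<open>The error of the spectral projection\<close>

lemma L2_proj_spectral_proj_bound:
  assumes "l \<in> \<Lambda>"
  shows "form_norm ah (L2_proj w - spectral_proj bh n lamh uh \<Lambda> w)
    \<le> spectral_gap_const n lamh \<Lambda> l *
      (dual_norm ah Vh (defect ah bh l w) + form_norm ah (galerkin_proj w - L2_proj w))"
proof -
  let ?\<gamma> = "spectral_gap_const n lamh \<Lambda> l"
  let ?z = "comb (\<lambda>i. defect ah bh l w (uh i) / lamh i)"
  define f where "f i = (if lamh i \<in> \<Lambda> then 0 else bh w (uh i))" for i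
  define g where
    "g i = defect ah bh l w (uh i) / lamh i - (ah w (uh i) / lamh i - bh w (uh i))" for i
  have f: "L2_proj w - spectral_proj bh n lamh uh \<Lambda> w = comb f"
    unfolding L2_proj_def spectral_proj_eq_comb sum_subtractf[symmetric] f_def
    by (intro sum.cong) auto
  have g: "?z - (galerkin_proj w - L2_proj w) = comb g"
    by (simp add: g_def galerkin_proj_def L2_proj_def sum_subtractf scaleR_left_diff_distrib)
  have "\<bar>f i\<bar> \<le> ?\<gamma> * \<bar>g i\<bar>" if i: "i \<in> {1..n}" for i
  proof (cases "lamh i \<in> \<Lambda>")
    case True
    then show ?thesis by (simp add: f_def spectral_gap_const_nonneg)
  next
    case False
    \<comment> \<open>\<open>l\<close> lies in \<open>\<Lambda>\<close> and \<open>lamh i\<close>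
      does not, so the division below is legitimate.\<close>
    have "lamh i - l \<noteq> 0" using False assms by auto
    \<comment> \<open>In \<open>g i\<close> the \<open>ah\<close> terms of the defect and of the
      Galerkin coefficient cancel, leaving \<open>(1 - l / lamh i) * bh w (uh i)\<close>.\<close>
    moreover have "(lamh i - l) * f i = lamh i * g i"
      using False lamh_positive[OF i] by (simp add: f_def g_def defect_def field_simps)
    ultimately have "f i = lamh i / (lamh i - l) * g i" by (simp add: field_simps)
    then have "\<bar>f i\<bar> = lamh i / \<bar>lamh i - l\<bar> * \<bar>g i\<bar>"
      using lamh_positive[OF i] by (simp add: abs_mult)
    also have "\<dots> \<le> ?\<gamma> * \<bar>g i\<bar>"
      by (intro mult_right_mono spectral_gap_const_ge i False) auto
    finally show ?thesis .
  qed
  then have "form_norm ah (comb f) \<le> ?\<gamma> * form_norm ah (comb g)"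
    by (intro form_norm_comb_le spectral_gap_const_nonneg)
  also have "\<dots> \<le> ?\<gamma> *
      (dual_norm ah Vh (defect ah bh l w) + form_norm ah (galerkin_proj w - L2_proj w))"
    using ah_diff_le[of ?z "galerkin_proj w - L2_proj w"]
      riesz_norm_le_dual_norm[OF linear_defect, of l w]
    by (intro mult_left_mono spectral_gap_const_nonneg) (simp add: g)
  finally show ?thesis by (simp add: f)
qed

text \<open>Split the error at \<open>L2_proj w\<close>. The same quantity \<open>?E\<close> bounds
  \<open>w - L2_proj w\<close>, with factor 1, and \<open>galerkin_proj w - L2_proj w\<close>, with
  factor \<open>\<gamma>\<close>; together they give \<open>\<gamma> + 1\<close>.\<close>

theorem spectral_proj_error:
  assumes "l \<in> \<Lambda>" and v: "v \<in> Vh"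
  shows "form_norm ah (w - spectral_proj bh n lamh uh \<Lambda> w)
    \<le> (spectral_gap_const n lamh \<Lambda> l + 1) *
        (sqrt (lamh n) * form_norm bh (w - v) + form_norm ah (w - v))
      + spectral_gap_const n lamh \<Lambda> l * dual_norm ah Vh (defect ah bh l w)"
proof -
  let ?\<gamma> = "spectral_gap_const n lamh \<Lambda> l"
  let ?e = "w - v"
  let ?E = "sqrt (lamh n) * form_norm bh ?e + form_norm ah ?e"
  let ?d = "dual_norm ah Vh (defect ah bh l w)"
  have P: "w - L2_proj w = ?e - L2_proj ?e"
    and RP: "galerkin_proj w - L2_proj w = galerkin_proj ?e - L2_proj ?e"
    using v by (simp_all add: L2_proj_diff galerkin_proj_diff L2_proj_id galerkin_proj_id)
  have "form_norm ah (w - L2_proj w) \<le> ?E"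
    unfolding P using ah_diff_le[of ?e "L2_proj ?e"] L2_proj_norm_le[of ?e] by simp
  moreover have "form_norm ah (galerkin_proj w - L2_proj w) \<le> ?E"
    using ah_diff_le[of "galerkin_proj ?e" "L2_proj ?e"] L2_proj_norm_le[of ?e]
      galerkin_proj_norm_le[of ?e] by (simp add: RP)
  then have "?\<gamma> * (?d + form_norm ah (galerkin_proj w - L2_proj w)) \<le> ?\<gamma> * (?d + ?E)"
    by (intro mult_left_mono spectral_gap_const_nonneg) simp
  ultimately show ?thesis
    using ah_triangle_ineq[of "w - L2_proj w" "L2_proj w - spectral_proj bh n lamh uh \<Lambda> w"]
      L2_proj_spectral_proj_bound[OF assms(1), of w]
    by (simp add: algebra_simps)
qed

end

theorem theorem6p3:
  fixes \<iota> :: "'h::{real_inner, complete_space} \<Rightarrow> 'g::{real_inner, complete_space}"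
    and a b :: "'h \<Rightarrow> 'h \<Rightarrow> real"
    and lam :: "nat \<Rightarrow> real"
    and u :: "nat \<Rightarrow> 'h"
    and ext :: "'h \<Rightarrow> 'e::real_vector"
    and ah bh :: "'e \<Rightarrow> 'e \<Rightarrow> real"
    and Vh :: "'e set"
    and n kmax k :: nat
    and lamh :: "nat \<Rightarrow> real"
    and uh :: "nat \<Rightarrow> 'e"
    and Interp :: "'e \<Rightarrow> 'e"
    and \<Lambda> :: "real set"
    and \<gamma> :: real
    and ue :: 'e
  assumes "elliptic_eigenproblem \<iota> a b lam u"
    and "linear ext" and "inj ext"
    and "discrete_eigenproblem ah bh Vh n lamh uh"
    and "1 \<le> k" and "k \<le> kmax"
    and "lam k \<in> interior \<Lambda>"
    and "linear_map_on (range ext) Interp" and "Interp ` range ext \<subseteq> Vh"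
    and "ue = ext (u k)"
    and "\<gamma> = spectral_gap_const n lamh \<Lambda> (lam k)"
  shows "form_norm ah (ue - spectral_proj bh n lamh uh \<Lambda> ue)
    \<le> (\<gamma> + 1) * (sqrt (lamh n) * form_norm bh (ue - Interp ue)
                   + 3 * form_norm ah (ue - Interp ue))
      + \<gamma> * dual_norm ah Vh (defect ah bh (lam k) ue)"
proof -
  interpret discrete_eigenproblem ah bh Vh n lamh uh by fact
  let ?e = "ue - Interp ue"
  have "lam k \<in> \<Lambda>" using assms(7) interior_subset by blast
  moreover have "Interp ue \<in> Vh" using assms(9,10) by blast
  ultimately have "form_norm ah (ue - spectral_proj bh n lamh uh \<Lambda> ue)
    \<le> (\<gamma> + 1) * (sqrt (lamh n) * form_norm bh ?e + form_norm ah ?e)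
      + \<gamma> * dual_norm ah Vh (defect ah bh (lam k) ue)"
    unfolding assms(11) by (rule spectral_proj_error)
  \<comment> \<open>The energy term already has constant 1; since \<open>\<gamma> + 1\<close> and
    the seminorm are nonnegative, raising it to 3 only enlarges the bound.\<close>
  also have "(\<gamma> + 1) * (sqrt (lamh n) * form_norm bh ?e + form_norm ah ?e)
    \<le> (\<gamma> + 1) * (sqrt (lamh n) * form_norm bh ?e + 3 * form_norm ah ?e)"
    using ah_norm_nonneg[of ?e] spectral_gap_const_nonneg[of \<Lambda> "lam k"] assms(11)
    by (intro mult_left_mono) auto
  finally show ?thesis by simp
qed

end
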